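(* There exists a constant $c>0$ such that for every sufficiently small $\epsilon>0$ and for infinitely many integers $n>0$ there is an instance $\mathcal{I}=(J,p,r,d)$ of $1|r_j,d_j|\sum_j p_jU'_j$ with $|J|=n$ jobs and $T:=\sum_{j\in J}p_j=\max_{j\in J}d_j$ such that: (i) every solution to $\mathcal{I}$ has cost at least $0.2T$; and (ii) $\mathrm{SA}(\mathcal{P}_{\mathcal{I}}(\epsilon T),\lfloor c\epsilon\log n\rfloor)\neq\emptyset$.
   Context: The problem $1|r_j,d_j|\sum_j p_jU'_j$: one machine and a set $J$ of jobs, each with size $p_j\in\mathbb{Z}_{>0}$, release time $r_j\in\mathbb{Z}_{\ge 0}$ and deadline $d_j\ge r_j+p_j$. A solution chooses for each job a length $p'_j\in[0,p_j]$ and, if $p'_j>0$, processes $j$ non-preemptively during an interval $(t,t+p'_j]\subseteq(r_j,d_j]$ with $t$ an integer, such that the processing intervals of different jobs are disjoint. Its cost is $\sum_{j\in J}(p_j-p'_j)$. The LP $\mathcal{P}_{\mathcal{I}}(B)$ has variables $x_{j,t,p'}$ for $j\in J$, $p'\in\{1,\dots,p_j\}$ and integer $t\in[r_j,d_j-p']$, and constraints: $\sum_j\big(p_j-\sum_{t,p'}x_{j,t,p'}\,p'\big)\le B$; $\sum_{t,p'}x_{j,t,p'}\le 1$ for all $j\in J$; $\sum_{(j,t,p'):\,t'\in(t,t+p']}x_{j,t,p'}\le 1$ for all $t'\in[T]$; $x_{j,t,p'}\ge 0$ for all variables. Sherali–Adams lift: for a linear system $\{\sum_i a_{k,i}x_i\le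 b_k\}_k$ over variable index set $V$ and an integer $r\ge 1$, $\mathrm{SA}(\mathcal{P},r)$ is the set of vectors $(x_S)_{S\subseteq V,|S|\le r}$ satisfying $x_\emptyset=1$ and, for every constraint $k$ and all $S,R\subseteq V$ with $|S|+|R|\le r-1$, the linearized constraint $\sum_{R'\subseteq R}(-1)^{|R'|}\big(\sum_{i}a_{k,i}\,x_{S\cup R'\cup\{i\}}-b_k\,x_{S\cup R'}\big)\le 0$. *)

theory Defs
  imports Complex_Main "HOL-Library.FuncSet" "HOL-Library.Disjoint_Sets"
begin

record job_instance =
  jobs :: "nat set"
  psize :: "nat \<Rightarrow> nat"
  release :: "nat \<Rightarrow> nat"
  deadline :: "nat \<Rightarrow> nat"

definition valid_instance :: "job_instance \<Rightarrow> bool" where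
  "valid_instance I \<longleftrightarrow> finite (jobs I) \<and>
     (\<forall>j\<in>jobs I. 0 < psize I j \<and> release I j + psize I j \<le> deadline I j)"

definition total_size :: "job_instance \<Rightarrow> nat" where
  "total_size I = (\<Sum>j\<in>jobs I. psize I j)"

definition horizon :: "job_instance \<Rightarrow> nat" where
  "horizon I = Max (deadline I ` jobs I)"

text \<open>
  A solution consists of the chosen lengths \<open>q\<close> (real, not necessarily integral) and the integral
  starting times \<open>s\<close>. The value \<open>s j\<close> is irrelevant if \<open>q j = 0\<close>: the interval
  \<open>(s j, s j + q j]\<close> is then empty.
\<close>
definition is_solution :: "job_instance \<Rightarrow> (nat \<Rightarrow> real) \<Rightarrow> (nat \<Rightarrow> int) \<Rightarrow> bool" where
  "is_solution I q s \<longleftrightarrow>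
     (\<forall>j\<in>jobs I. 0 \<le> q j \<and> q j \<le> real (psize I j) \<and>
        (0 < q j \<longrightarrow>
          {real_of_int (s j)<..real_of_int (s j) + q j}
            \<subseteq> {real (release I j)<..real (deadline I j)})) \<and>
     disjoint_family_on (\<lambda>j. {real_of_int (s j)<..real_of_int (s j) + q j}) (jobs I)"

definition solution_cost :: "job_instance \<Rightarrow> (nat \<Rightarrow> real) \<Rightarrow> real" where
  "solution_cost I q = (\<Sum>j\<in>jobs I. real (psize I j) - q j)"

text \<open>
  A linear system is a set of pairs \<open>(a, b)\<close>, each standing for the constraint
  \<open>(\<Sum>i\<in>V. a i * x i) \<le> b\<close>; \<open>V\<close> is the finite set of variable indices.
  The side condition \<open>|S| + |R| \<le> r - 1\<close> is written without truncated subtraction.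
\<close>
type_synonym 'v linear_system = "(('v \<Rightarrow> real) \<times> real) set"

definition SA :: "'v set \<Rightarrow> 'v linear_system \<Rightarrow> nat \<Rightarrow> ('v set \<Rightarrow> real) set" where
  "SA V P r =
     {x \<in> extensional {S. S \<subseteq> V \<and> card S \<le> r}.
        x {} = 1 \<and>
        (\<forall>(a, b)\<in>P. \<forall>S R. S \<subseteq> V \<longrightarrow> R \<subseteq> V \<longrightarrow> card S + card R + 1 \<le> r \<longrightarrow>
           (\<Sum>R'\<in>Pow R. (-1) ^ card R' *
              ((\<Sum>i\<in>V. a i * x (S \<union> R' \<union> {i})) - b * x (S \<union> R'))) \<le> 0)}"

text \<open>The variable \<open>x\<^bsub>j,t,q\<^esub>\<close> is indexed by the triple \<open>(j, t, q)\<close>.\<close>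
definition lp_vars :: "job_instance \<Rightarrow> (nat \<times> nat \<times> nat) set" where
  "lp_vars I = {(j, t, q). j \<in> jobs I \<and> 1 \<le> q \<and> q \<le> psize I j \<and>
                           release I j \<le> t \<and> t + q \<le> deadline I j}"

text \<open>
  The first constraint is the cost bound \<open>(\<Sum>j. psize I j - (\<Sum>t q. x (j,t,q) * q)) \<le> B\<close>
  with the constant part moved to the right-hand side.
\<close>
definition lp_system :: "job_instance \<Rightarrow> real \<Rightarrow> (nat \<times> nat \<times> nat) linear_system" where
  "lp_system I B =
     {(\<lambda>(j, t, q). - real q, B - (\<Sum>j\<in>jobs I. real (psize I j)))} \<union>
     {(\<lambda>(j, t, q). if j = j' then 1 else 0, 1) | j'. j' \<in> jobs I} \<union>
     {(\<lambda>(j, t, q). if t' \<in> {t<..t + q} then 1 else 0, 1) | t'. t' \<in> {1..horizon I}} \<union>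
     {(\<lambda>w. if w = v then -1 else 0, 0) | v. v \<in> lp_vars I}"

end

theory Submission
  imports Defs "HOL-Library.Discrete_Functions"
begin

text \<open>
  The instance has \<open>K\<close> levels. Level \<open>i\<close> splits the time line of length \<open>T = K * 2 ^ K\<close> into
  \<open>2 ^ i\<close> windows of equal length, and each of them carries one job whose size is \<open>1 / K\<close> of the
  window; so every level has total size \<open>T / K\<close>.

  Integrality gap: a window covered by a job of a much lower level loses its job. Hence level \<open>i\<close>
  loses almost the fraction of its jobs that is covered by the levels below \<open>i - 6\<close>. If the total
  cost is \<open>\<delta> T\<close>, that fraction is about \<open>i / K - \<delta>\<close> or more, and summing over \<open>i\<close> gives
  \<open>\<delta> \<ge> 1 / 2 - \<delta>\<close> up to small errors.

  Sherali-Adams: cut each window into \<open>K\<close> slots and give a set \<open>S\<close> of pairwise compatible slots the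
  value \<open>p ^ |S|\<close> with \<open>p = (1 - \<epsilon> / 4) / K\<close>, and all other sets the value 0. Every job constraint
  and every time constraint is a clique of at most \<open>K\<close> slots, so it holds with slack \<open>\<epsilon> / 4\<close>; and
  conditioning on one slot costs only \<open>O(T / K)\<close>. In the lifted constraint for \<open>S, R\<close> the term
  \<open>R' = {}\<close> has this slack, and the remaining terms are at most \<open>(1 + p) ^ |R| - 1 = O(r / K)\<close>
  relative to it, which the slack absorbs as long as \<open>r \<le> \<epsilon> K / 16\<close>. Since \<open>n = 2 ^ K - 1\<close>,
  this allows \<open>r\<close> of order \<open>\<epsilon> ln n\<close>.
\<close>

section \<open>Hard-core pseudo-distributions\<close>

text \<open>Pairing each \<open>U\<close> without \<open>v\<close> with \<open>insert v U\<close>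
  cancels the sum. This settles the lifted constraints in which \<open>S\<close> and
  \<open>R\<close> share an element \<open>v\<close>.\<close>

lemma alternating_sum_Pow_zero:
  fixes f :: "'v set \<Rightarrow> real"
  assumes fin: "finite R" and v: "v \<in> R" and f: "\<And>U. f (insert v U) = f U"
  shows "(\<Sum>R'\<in>Pow R. (-1) ^ card R' * f R') = 0"
proof -
  define P where "P = Pow (R - {v})"
  have finP: "finite P" using fin by (simp add: P_def)
  have split: "Pow R = P \<union> insert v ` P"
    using v unfolding P_def by (metis Pow_insert insert_Diff)
  have disj: "P \<inter> insert v ` P = {}" by (auto simp: P_def)
  have inj: "inj_on (insert v) P"
    by (rule inj_on_inverseI[where g = "\<lambda>U. U - {v}"]) (auto simp: P_def)
  have neg: "(-1) ^ card (insert v U) * f (insert v U) = - ((-1) ^ card U * f U)" if "U \<in> P" for U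
  proof -
    have "v \<notin> U" "finite U" using that fin by (auto simp: P_def intro: finite_subset)
    then show ?thesis by (simp add: f)
  qed
  have "(\<Sum>R'\<in>Pow R. (-1) ^ card R' * f R')
      = (\<Sum>U\<in>P. (-1) ^ card U * f U) + (\<Sum>U\<in>P. (-1) ^ card (insert v U) * f (insert v U))"
    using finP disj inj by (simp add: split sum.union_disjoint sum.reindex)
  also have "\<dots> = 0" using neg by (simp add: sum_negf)
  finally show ?thesis .
qed

lemma sum_Pow_power_card:
  fixes p :: real
  assumes "finite R"
  shows "(\<Sum>R'\<in>Pow R. p ^ card R') = (1 + p) ^ card R"
  using assms
proof (induction R)
  case empty
  then show ?case by simp
next
  case (insert v R)
  have disj: "Pow R \<inter> insert v ` Pow R = {}" using insert.hyps by auto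
  have inj: "inj_on (insert v) (Pow R)"
    using insert.hyps by (intro inj_on_inverseI[where g = "\<lambda>U. U - {v}"]) auto
  have c: "card (insert v U) = Suc (card U)" if "U \<in> Pow R" for U
    using that insert.hyps by (intro card_insert_disjoint) (auto intro: finite_subset)
  have "(\<Sum>R'\<in>Pow (insert v R). p ^ card R') = (\<Sum>U\<in>Pow R. p ^ card U) + (\<Sum>U\<in>Pow R. p ^ card (insert v U))"
    using insert.hyps disj inj by (simp add: Pow_insert sum.union_disjoint sum.reindex)
  also have "(\<Sum>U\<in>Pow R. p ^ card (insert v U)) = p * (\<Sum>U\<in>Pow R. p ^ card U)"
    using c by (simp add: sum_distrib_left)
  finally show ?case using insert by (simp add: algebra_simps)
qed

text \<open>The negative term of the empty set outweighs all the others. These are bounded in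
  absolute value, regardless of sign, and by the binomial sum their total is at most
  \<open>C * w * ((1 + p) ^ card R - 1)\<close>.\<close>

lemma alternating_sum_nonpos:
  fixes g :: "'v set \<Rightarrow> real"
  assumes fin: "finite R" and w: "w \<ge> 0"
    and g0: "g {} \<le> - \<eta> * w"
    and g: "\<And>R'. R' \<subseteq> R \<Longrightarrow> \<bar>g R'\<bar> \<le> C * w * p ^ card R'"
    and small: "((1 + p) ^ card R - 1) * C \<le> \<eta>"
  shows "(\<Sum>R'\<in>Pow R. (-1) ^ card R' * g R') \<le> 0"
proof -
  have "(\<Sum>R'\<in>Pow R - {{}}. (-1) ^ card R' * g R') \<le> (\<Sum>R'\<in>Pow R - {{}}. C * w * p ^ card R')"
  proof (rule sum_mono)
    fix R' assume "R' \<in> Pow R - {{}}"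
    then have "\<bar>g R'\<bar> \<le> C * w * p ^ card R'" using g by auto
    then show "(-1) ^ card R' * g R' \<le> C * w * p ^ card R'"
      by (cases "even (card R')") auto
  qed
  also have "\<dots> = C * w * ((\<Sum>R'\<in>Pow R. p ^ card R') - 1)"
    using fin by (simp add: sum_distrib_left[symmetric] sum_diff1)
  also have "\<dots> = w * (((1 + p) ^ card R - 1) * C)"
    using fin by (simp add: sum_Pow_power_card)
  also have "\<dots> \<le> w * \<eta>" using small w by (rule mult_left_mono)
  finally have "(\<Sum>R'\<in>Pow R - {{}}. (-1) ^ card R' * g R') \<le> w * \<eta>" .
  moreover have "(\<Sum>R'\<in>Pow R. (-1) ^ card R' * g R') = g {} + (\<Sum>R'\<in>Pow R - {{}}. (-1) ^ card R' * g R')"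
    using fin by (subst sum.remove[of _ "{}"]) auto
  ultimately show ?thesis using g0 by (simp add: mult.commute)
qed

section \<open>Weights on independent sets and their conditional marginals\<close>

text \<open>\<open>V\<close> stands for all LP variables, \<open>A\<close> for those that may get a
  positive value, and \<open>cf\<close> for the conflict graph. Only lifted constraints of bounded
  order have to hold, so no actual distribution with these moments is constructed.\<close>

locale hard_core =
  fixes V A :: "'v set" and cf :: "'v \<Rightarrow> 'v \<Rightarrow> bool" and p :: real
  assumes finV: "finite V" and AV: "A \<subseteq> V"
    and cf_sym: "cf u v \<Longrightarrow> cf v u"
    and p0: "0 \<le> p"
begin

text \<open>The test \<open>u \<noteq> v\<close> allows for a reflexive conflict relation, as
  \<open>slot_conflict\<close> is.\<close>

definition indep :: "'v set \<Rightarrow> bool" where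
  "indep U \<longleftrightarrow> U \<subseteq> A \<and> (\<forall>u\<in>U. \<forall>v\<in>U. u \<noteq> v \<longrightarrow> \<not> cf u v)"

definition weight :: "'v set \<Rightarrow> real" where
  "weight U = (if indep U then p ^ card U else 0)"

text \<open>The marginal of \<open>i\<close> conditioned on \<open>U\<close>, that is, \<open>weight (insert i U) / weight U\<close>.\<close>
definition marg :: "'v set \<Rightarrow> 'v \<Rightarrow> real" where
  "marg U i = (if i \<in> U then 1 else if i \<in> A \<and> (\<forall>u\<in>U. \<not> cf u i) then p else 0)"

lemma indep_mono: "indep U \<Longrightarrow> U' \<subseteq> U \<Longrightarrow> indep U'"
  unfolding indep_def by blast

lemma indep_finite: "indep U \<Longrightarrow> finite U"
  unfolding indep_def using finV AV by (meson finite_subset)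

lemma marg_nonneg: "0 \<le> marg U i"
  using p0 by (simp add: marg_def)

lemma weight_insert:
  assumes "indep U"
  shows "weight (insert i U) = weight U * marg U i"
proof (cases "i \<in> U")
  case True
  then have "insert i U = U" by auto
  then show ?thesis using True by (simp add: marg_def)
next
  case False
  have "indep (insert i U) \<longleftrightarrow> i \<in> A \<and> (\<forall>u\<in>U. \<not> cf u i)"
    using assms False unfolding indep_def by (auto dest: cf_sym)
  then show ?thesis
    using assms False indep_finite[OF assms] by (simp add: weight_def marg_def)
qed

text \<open>Reduces a linearized constraint to the original one evaluated at the marginals
  conditioned on \<open>U\<close>. If \<open>U\<close> is not independent, neither is any superset,
  and both sides vanish.\<close>

lemma weight_slack:
  "(\<Sum>i\<in>V. a i * weight (insert i U)) - b * weight U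
     = weight U * ((\<Sum>i\<in>V. a i * marg U i) - b)"
proof (cases "indep U")
  case True
  then show ?thesis
    by (simp add: weight_insert sum_distrib_left algebra_simps)
next
  case False
  then have "\<not> indep (insert i U)" for i using indep_mono by blast
  then show ?thesis using False by (simp add: weight_def)
qed

definition slack :: "('v \<Rightarrow> real) \<Rightarrow> real \<Rightarrow> 'v set \<Rightarrow> real" where
  "slack a b U = b - (\<Sum>i\<in>V. a i * marg U i)"

text \<open>The sum vanishes if \<open>S\<close> meets \<open>R\<close>, if \<open>S\<close> is not
  independent, or if the constraint is tight after every conditioning that extends \<open>S\<close>.
  Otherwise the slack \<open>\<eta>\<close> at \<open>S\<close> dominates the terms with nonempty
  \<open>R'\<close>, since each further element costs a factor \<open>p\<close>.\<close>

lemma lifted_constraint: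
  assumes fin: "finite S" "finite R"
    and bnd: "\<And>U. indep U \<Longrightarrow> card U \<le> card S + card R \<Longrightarrow> \<bar>slack a b U\<bar> \<le> C"
    and base: "indep S \<Longrightarrow> \<eta> \<le> slack a b S \<or> (\<forall>U. indep U \<longrightarrow> S \<subseteq> U \<longrightarrow> slack a b U = 0)"
    and small: "((1 + p) ^ card R - 1) * C \<le> \<eta>"
  shows "(\<Sum>R'\<in>Pow R. (-1) ^ card R' *
            ((\<Sum>i\<in>V. a i * weight (S \<union> R' \<union> {i})) - b * weight (S \<union> R'))) \<le> 0"
    (is "?L \<le> 0")
proof -
  define g where "g R' = - weight (S \<union> R') * slack a b (S \<union> R')" for R'
  have L: "?L = (\<Sum>R'\<in>Pow R. (-1) ^ card R' * g R')"
    by (intro sum.cong refl) (simp add: weight_slack g_def slack_def algebra_simps)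
  consider v where "v \<in> S" "v \<in> R" | "\<not> indep S"
    | "indep S" "\<forall>U. indep U \<longrightarrow> S \<subseteq> U \<longrightarrow> slack a b U = 0"
    | "S \<inter> R = {}" "indep S" "\<eta> \<le> slack a b S"
    using base by blast
  then show ?thesis
  proof cases
    case 1
    then have "g (insert v U) = g U" for U by (simp add: g_def insert_absorb)
    then show ?thesis using alternating_sum_Pow_zero[OF fin(2) 1(2)] L by simp
  next
    case 2
    then have "\<not> indep (S \<union> R')" for R' using indep_mono by blast
    then have "g R' = 0" for R' by (simp add: g_def weight_def)
    then show ?thesis unfolding L by simp
  next
    case 3
    then have "g R' = 0" for R' by (simp add: g_def weight_def)
    then show ?thesis unfolding L by simp
  next
    case 4
    have "\<bar>g R'\<bar> \<le> C * p ^ card S * p ^ card R'" if "R' \<subseteq> R" for R'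
    proof (cases "indep (S \<union> R')")
      case True
      have fR: "finite R'" using that fin finite_subset by blast
      \<comment> \<open>Disjointness of \<open>S\<close> and \<open>R\<close> is what makes the
        weight of the union factor as \<open>p ^ card S * p ^ card R'\<close>.\<close>
      have c: "card (S \<union> R') = card S + card R'"
        using fin fR 4(1) that by (intro card_Un_disjoint) auto
      have "card R' \<le> card R" using that fin by (simp add: card_mono)
      then have "\<bar>slack a b (S \<union> R')\<bar> \<le> C" using bnd True c by simp
      then have "p ^ card (S \<union> R') * \<bar>slack a b (S \<union> R')\<bar> \<le> p ^ card (S \<union> R') * C"
        using p0 by (intro mult_left_mono) auto
      then show ?thesis using True p0 c
        by (simp add: g_def weight_def abs_mult power_add algebra_simps)
    next
      case False
      have "0 \<le> C" using bnd[of S] 4 by fastforce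
      then show ?thesis using False p0 by (simp add: g_def weight_def)
    qed
    moreover have "g {} \<le> - \<eta> * p ^ card S"
      using 4 p0 mult_right_mono[of \<eta> "slack a b S" "p ^ card S"] by (simp add: g_def weight_def mult.commute)
    ultimately show ?thesis
      unfolding L using alternating_sum_nonpos[OF fin(2), of "p ^ card S" g \<eta> C p] p0 small by simp
  qed
qed

section \<open>Lifted nonnegativity and clique constraints\<close>

text \<open>Nonnegativity of the variable \<open>v\<close> lifted at \<open>S\<close> is the same as
  the trivial constraint \<open>0 \<le> 1\<close> lifted at \<open>insert v S\<close>, whose slack
  is constantly 1.\<close>

lemma lifted_nonneg:
  assumes fin: "finite S" "finite R" and v: "v \<in> V" and small: "(1 + p) ^ card R \<le> 2"
  shows "(\<Sum>R'\<in>Pow R. (-1) ^ card R' *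
            ((\<Sum>i\<in>V. (if i = v then -1 else 0) * weight (S \<union> R' \<union> {i})) - 0 * weight (S \<union> R'))) \<le> 0"
proof -
  have *: "(\<Sum>i\<in>V. (if i = v then -1 else 0) * weight (S \<union> R' \<union> {i}))
      = (\<Sum>i\<in>V. 0 * weight (insert v S \<union> R' \<union> {i})) - 1 * weight (insert v S \<union> R')" for R'
  proof -
    have "(\<Sum>i\<in>V. (if i = v then -1 else 0) * weight (S \<union> R' \<union> {i}))
        = (\<Sum>i\<in>V. if i = v then - weight (S \<union> R' \<union> {i}) else 0)"
      by (intro sum.cong) auto
    also have "\<dots> = - weight (S \<union> R' \<union> {v})" using finV v by (simp add: sum.delta)
    finally show ?thesis by simp
  qed
  have "(\<Sum>R'\<in>Pow R. (-1) ^ card R' *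
            ((\<Sum>i\<in>V. 0 * weight (insert v S \<union> R' \<union> {i})) - 1 * weight (insert v S \<union> R'))) \<le> 0"
    using fin small by (intro lifted_constraint[where C = 1 and \<eta> = 1]) (auto simp: slack_def)
  then show ?thesis unfolding * by simp
qed

text \<open>Once \<open>u\<close> is chosen it has marginal 1, while every other element of
  \<open>Q\<close> lies outside \<open>A\<close> or conflicts with \<open>u\<close> and gets 0. So
  the clique constraint becomes tight.\<close>

lemma clique_marg_hit:
  assumes U: "indep U" and Q: "Q \<subseteq> V" "\<And>u v. u \<in> Q \<inter> A \<Longrightarrow> v \<in> Q \<inter> A \<Longrightarrow> u \<noteq> v \<Longrightarrow> cf u v"
    and u: "u \<in> U" "u \<in> Q"
  shows "(\<Sum>i\<in>Q. marg U i) = 1"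
proof -
  have uA: "u \<in> A" using U u by (auto simp: indep_def)
  have "marg U i = (if i = u then 1 else 0)" if "i \<in> Q" for i
    using that u uA U Q(2)[of u i] unfolding marg_def indep_def by (auto dest: cf_sym)
  then have "(\<Sum>i\<in>Q. marg U i) = (\<Sum>i\<in>Q. if i = u then 1 else 0)" by (intro sum.cong) auto
  also have "\<dots> = 1" using finite_subset[OF Q(1) finV] u by simp
  finally show ?thesis .
qed

lemma clique_marg_miss:
  assumes Q: "Q \<subseteq> V" and "U \<inter> Q = {}"
  shows "(\<Sum>i\<in>Q. marg U i) \<le> p * card (Q \<inter> A)"
proof -
  have fQ: "finite Q" using finite_subset[OF Q finV] .
  have "(\<Sum>i\<in>Q. marg U i) \<le> (\<Sum>i\<in>Q. if i \<in> A then p else 0)"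
    using assms p0 by (intro sum_mono) (auto simp: marg_def)
  also have "\<dots> = p * card (Q \<inter> A)"
    using fQ by (simp add: sum.inter_restrict[symmetric])
  finally show ?thesis .
qed

text \<open>The two alternatives of \<open>lifted_constraint\<close>: if \<open>S\<close> hits the
  clique, the slack is 0 for all independent supersets of \<open>S\<close>; if it misses, the load
  bound leaves slack \<open>\<eta>\<close>.\<close>

lemma lifted_clique:
  assumes fin: "finite S" "finite R"
    and Q: "Q \<subseteq> V" "\<And>u v. u \<in> Q \<inter> A \<Longrightarrow> v \<in> Q \<inter> A \<Longrightarrow> u \<noteq> v \<Longrightarrow> cf u v"
    and load: "p * card (Q \<inter> A) \<le> 1 - \<eta>" and \<eta>: "0 \<le> \<eta>"
    and small: "(1 + p) ^ card R - 1 \<le> \<eta>"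
    and a: "\<And>i. i \<in> V \<Longrightarrow> a i = (if i \<in> Q then 1 else 0)"
  shows "(\<Sum>R'\<in>Pow R. (-1) ^ card R' *
            ((\<Sum>i\<in>V. a i * weight (S \<union> R' \<union> {i})) - 1 * weight (S \<union> R'))) \<le> 0"
proof -
  have sl: "slack a 1 U = 1 - (\<Sum>i\<in>Q. marg U i)" for U
  proof -
    have "(\<Sum>i\<in>V. a i * marg U i) = (\<Sum>i\<in>V. if i \<in> Q then marg U i else 0)"
      using a by (intro sum.cong) auto
    also have "\<dots> = (\<Sum>i\<in>V \<inter> Q. marg U i)"
      using finV by (simp add: sum.inter_restrict)
    finally show ?thesis using Q(1) by (simp add: slack_def Int_absorb1)
  qed
  have hit: "slack a 1 U = 0" if "indep U" "U \<inter> Q \<noteq> {}" for U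
    using that clique_marg_hit[OF that(1) Q] unfolding sl by auto
  have miss: "\<eta> \<le> slack a 1 U" if "U \<inter> Q = {}" for U
    using clique_marg_miss[OF Q(1) that] load unfolding sl by linarith
  have le1: "slack a 1 U \<le> 1" for U
    unfolding sl using sum_nonneg[of Q "marg U"] marg_nonneg by simp
  show ?thesis
  proof (rule lifted_constraint[OF fin, where C = 1 and \<eta> = \<eta>])
    show "\<bar>slack a 1 U\<bar> \<le> 1" if "indep U" for U
      using hit[OF that] miss[of U] le1[of U] \<eta> by fastforce
    show "\<eta> \<le> slack a 1 S \<or> (\<forall>U. indep U \<longrightarrow> S \<subseteq> U \<longrightarrow> slack a 1 U = 0)"
    proof (cases "S \<inter> Q = {}")
      case False
      then have "U \<inter> Q \<noteq> {}" if "S \<subseteq> U" for U using that by auto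
      then show ?thesis using hit by simp
    qed (simp add: miss)
  qed (use small in simp)
qed

text \<open>An element keeps at least its unconditioned marginal \<open>p\<close> unless some
  \<open>u\<close> in \<open>U\<close> conflicts with it; in that case its share
  \<open>p * f i\<close> is charged to such a \<open>u\<close>. Each \<open>u\<close> is charged at
  most \<open>p * L\<close>. By reflexivity the members of \<open>U\<close> fall under the charged
  case.\<close>

lemma marg_sum_lower:
  assumes U: "indep U" and f: "\<And>i. i \<in> A \<Longrightarrow> 0 \<le> f i"
    and loss: "\<And>u. u \<in> A \<Longrightarrow> (\<Sum>i\<in>{i\<in>A. cf u i}. f i) \<le> L"
    and cf_refl: "\<And>u. u \<in> A \<Longrightarrow> cf u u"
  shows "p * (\<Sum>i\<in>A. f i) - p * card U * L \<le> (\<Sum>i\<in>A. f i * marg U i)"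
proof -
  have finA: "finite A" using finV AV finite_subset by blast
  have "(\<Sum>i\<in>A. p * f i) \<le> (\<Sum>i\<in>A. f i * marg U i + (\<Sum>u\<in>U. if cf u i then p * f i else 0))"
  proof (rule sum_mono)
    fix i assume i: "i \<in> A"
    have nn: "0 \<le> (\<Sum>u\<in>U. if cf u i then p * f i else 0)"
      using f[OF i] p0 by (intro sum_nonneg) auto
    show "p * f i \<le> f i * marg U i + (\<Sum>u\<in>U. if cf u i then p * f i else 0)"
    proof (cases "\<exists>u\<in>U. cf u i")
      case True
      then obtain u where u: "u \<in> U" "cf u i" by blast
      have "(if cf u i then p * f i else 0) \<le> (\<Sum>u\<in>U. if cf u i then p * f i else 0)"
        using f[OF i] p0 u indep_finite[OF U]
        by (intro member_le_sum[where f = "\<lambda>u. if cf u i then p * f i else 0"]) auto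
      moreover have "0 \<le> f i * marg U i" using f[OF i] marg_nonneg by simp
      ultimately show ?thesis using u by simp
    next
      case False
      then have "i \<notin> U" using cf_refl i by blast
      then have "marg U i = p" using False i by (simp add: marg_def)
      then show ?thesis using nn by (simp add: mult.commute)
    qed
  qed
  also have "\<dots> = (\<Sum>i\<in>A. f i * marg U i) + (\<Sum>u\<in>U. \<Sum>i\<in>A. if cf u i then p * f i else 0)"
    by (simp add: sum.distrib sum.swap[of _ A U])
  also have "(\<Sum>u\<in>U. \<Sum>i\<in>A. if cf u i then p * f i else 0) \<le> (\<Sum>u\<in>U. p * L)"
  proof (rule sum_mono)
    fix u assume "u \<in> U"
    then have "u \<in> A" using U by (auto simp: indep_def)
    have "(\<Sum>i\<in>A. if cf u i then p * f i else 0) = p * (\<Sum>i\<in>{i\<in>A. cf u i}. f i)"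
      using finA by (simp add: sum_distrib_left sum.inter_filter if_distrib cong: if_cong)
    also have "\<dots> \<le> p * L" using loss[OF \<open>u \<in> A\<close>] p0 by (rule mult_left_mono)
    finally show "(\<Sum>i\<in>A. if cf u i then p * f i else 0) \<le> p * L" .
  qed
  finally show ?thesis by (simp add: sum_distrib_left algebra_simps)
qed

text \<open>\<open>SA\<close> contains only vectors that are undefined on sets of size above
  \<open>r\<close>. Every set in a lifted constraint has size at most
  \<open>card S + card R + 1\<close>, so the restriction changes none of the values used.\<close>

lemma restrict_weight_in_SA:
  assumes "\<And>a b S R. (a, b) \<in> P \<Longrightarrow> finite S \<Longrightarrow> finite R \<Longrightarrow> card S + card R + 1 \<le> r \<Longrightarrow>
    (\<Sum>R'\<in>Pow R. (-1) ^ card R' *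
        ((\<Sum>i\<in>V. a i * weight (S \<union> R' \<union> {i})) - b * weight (S \<union> R'))) \<le> 0"
  shows "restrict weight {S. S \<subseteq> V \<and> card S \<le> r} \<in> SA V P r"
proof -
  let ?D = "{S. S \<subseteq> V \<and> card S \<le> r}"
  have "(\<Sum>R'\<in>Pow R. (-1) ^ card R' * ((\<Sum>i\<in>V. a i * restrict weight ?D (S \<union> R' \<union> {i}))
            - b * restrict weight ?D (S \<union> R'))) \<le> 0"
    if ab: "(a, b) \<in> P" and V: "S \<subseteq> V" "R \<subseteq> V" and r: "card S + card R + 1 \<le> r" for a b S R
  proof -
    have fin: "finite S" "finite R" using V finV finite_subset by blast+
    have D: "S \<union> R' \<in> ?D" "i \<in> V \<Longrightarrow> S \<union> R' \<union> {i} \<in> ?D" if "R' \<in> Pow R" for R' i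
    proof -
      have "finite R'" "card R' \<le> card R" using that fin by (auto intro: finite_subset card_mono)
      then have "card (S \<union> R') \<le> card S + card R"
        using card_Un_le[of S R'] by linarith
      moreover have "card (S \<union> R' \<union> {i}) \<le> card (S \<union> R') + 1"
        using card_Un_le[of "S \<union> R'" "{i}"] by simp
      ultimately show "S \<union> R' \<in> ?D" "i \<in> V \<Longrightarrow> S \<union> R' \<union> {i} \<in> ?D" using that V r by auto
    qed
    have "(\<Sum>R'\<in>Pow R. (-1) ^ card R' * ((\<Sum>i\<in>V. a i * restrict weight ?D (S \<union> R' \<union> {i}))
            - b * restrict weight ?D (S \<union> R')))
        = (\<Sum>R'\<in>Pow R. (-1) ^ card R' *
            ((\<Sum>i\<in>V. a i * weight (S \<union> R' \<union> {i})) - b * weight (S \<union> R')))"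
    proof (rule sum.cong[OF refl])
      fix R' assume R': "R' \<in> Pow R"
      have "(\<Sum>i\<in>V. a i * restrict weight ?D (S \<union> R' \<union> {i})) = (\<Sum>i\<in>V. a i * weight (S \<union> R' \<union> {i}))"
        by (rule sum.cong[OF refl], subst restrict_apply', rule D(2)[OF R'], assumption, rule refl)
      moreover have "restrict weight ?D (S \<union> R') = weight (S \<union> R')"
        by (rule restrict_apply'[OF D(1)[OF R']])
      ultimately show "(-1) ^ card R' * ((\<Sum>i\<in>V. a i * restrict weight ?D (S \<union> R' \<union> {i}))
            - b * restrict weight ?D (S \<union> R')) = (-1) ^ card R' *
            ((\<Sum>i\<in>V. a i * weight (S \<union> R' \<union> {i})) - b * weight (S \<union> R'))" by (simp only:)
    qed
    then show ?thesis using assms[OF ab fin r] by (simp only:)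
  qed
  moreover have "restrict weight ?D {} = 1" by (simp add: weight_def indep_def)
  ultimately show ?thesis unfolding SA_def by blast
qed

lemma marg_outside: "i \<notin> A \<Longrightarrow> indep U \<Longrightarrow> marg U i = 0"
  by (auto simp: marg_def indep_def)

end

section \<open>The dyadic instance\<close>

text \<open>The job of the \<open>a\<close>-th window (from 0) of level \<open>i\<close> has the number \<open>2 ^ i + a\<close>.\<close>
definition gap_instance :: "nat \<Rightarrow> job_instance" where
  "gap_instance K = \<lparr>jobs = {1..<2 ^ K},
     psize = (\<lambda>j. 2 ^ (K - floor_log j)),
     release = (\<lambda>j. (j - 2 ^ floor_log j) * (K * 2 ^ (K - floor_log j))),
     deadline = (\<lambda>j. Suc (j - 2 ^ floor_log j) * (K * 2 ^ (K - floor_log j)))\<rparr>"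

lemma floor_log_add: "a < 2 ^ i \<Longrightarrow> floor_log (2 ^ i + a) = i"
  by (rule floor_log_eqI) auto

lemma gap_instance_simps:
  "jobs (gap_instance K) = {1..<2 ^ K}"
  "a < 2 ^ i \<Longrightarrow> psize (gap_instance K) (2 ^ i + a) = 2 ^ (K - i)"
  "a < 2 ^ i \<Longrightarrow> release (gap_instance K) (2 ^ i + a) = a * (K * 2 ^ (K - i))"
  "a < 2 ^ i \<Longrightarrow> deadline (gap_instance K) (2 ^ i + a) = Suc a * (K * 2 ^ (K - i))"
  by (simp_all add: gap_instance_def floor_log_add)

lemma sum_dyadic_blocks:
  fixes f :: "nat \<Rightarrow> 'a::comm_monoid_add"
  shows "(\<Sum>j\<in>{1..<2 ^ K}. f j) = (\<Sum>i<K. \<Sum>a<2 ^ i. f (2 ^ i + a))"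
proof (induction K)
  case 0
  then show ?case by simp
next
  case (Suc K)
  have "(\<Sum>j\<in>{1..<2 ^ Suc K}. f j) = (\<Sum>j\<in>{1..<2 ^ K}. f j) + (\<Sum>j\<in>{2 ^ K..<2 ^ Suc K}. f j)"
    by (rule sum.atLeastLessThan_concat[symmetric]) auto
  also have "(\<Sum>j\<in>{2 ^ K..<2 ^ Suc K}. f j) = (\<Sum>a<2 ^ K. f (2 ^ K + a))"
    by (simp add: sum.atLeastLessThan_shift_0[of f "2 ^ K"] atLeast0LessThan)
  finally show ?case using Suc.IH by simp
qed

lemma job_cases:
  assumes "(j::nat) \<in> {1..<2 ^ K}"
  obtains i a where "i < K" "a < 2 ^ i" "j = 2 ^ i + a"
proof -
  have le: "2 ^ floor_log j \<le> j" using assms by (intro floor_log_exp2_le) auto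
  have gt: "j < 2 * 2 ^ floor_log j" by (rule floor_log_exp2_gt)
  have "2 ^ floor_log j < (2::nat) ^ K" using le assms by (meson atLeastLessThan_iff le_less_trans)
  then have "floor_log j < K" by simp
  then show ?thesis using le gt by (intro that[of "floor_log j" "j - 2 ^ floor_log j"]) auto
qed

lemma dyadic_mem:
  assumes "i < K" "a < 2 ^ i"
  shows "2 ^ i + a \<in> {1..<(2::nat) ^ K}"
proof -
  have "2 ^ i + a < 2 ^ Suc i" using assms by simp
  also have "\<dots> \<le> (2::nat) ^ K" using assms by (intro power_increasing) auto
  finally show ?thesis by (simp add: Suc_le_eq)
qed

lemma pow2_split: "i \<le> K \<Longrightarrow> (2::nat) ^ i * 2 ^ (K - i) = 2 ^ K"
  by (simp flip: power_add)

lemma total_size_gap_instance: "total_size (gap_instance K) = K * 2 ^ K"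
proof -
  have "total_size (gap_instance K) = (\<Sum>i<K. \<Sum>a<(2::nat) ^ i. 2 ^ (K - i))"
    unfolding total_size_def gap_instance_simps(1) sum_dyadic_blocks
    by (intro sum.cong refl gap_instance_simps(2)) auto
  also have "\<dots> = (\<Sum>i<K. 2 ^ K)"
    by (intro sum.cong) (auto simp: pow2_split)
  finally show ?thesis by simp
qed

lemma deadline_le: "j \<in> jobs (gap_instance K) \<Longrightarrow> deadline (gap_instance K) j \<le> K * 2 ^ K"
proof -
  assume "j \<in> jobs (gap_instance K)"
  then obtain i a where ia: "i < K" "a < 2 ^ i" "j = 2 ^ i + a"
    unfolding gap_instance_simps(1) by (rule job_cases)
  have "Suc a * (K * 2 ^ (K - i)) \<le> 2 ^ i * (K * 2 ^ (K - i))"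
    using ia by (intro mult_right_mono) auto
  also have "\<dots> = K * (2 ^ i * 2 ^ (K - i))" by (simp add: mult_ac)
  finally show ?thesis using ia by (simp add: gap_instance_simps pow2_split)
qed

lemma horizon_gap_instance:
  assumes "K > 0"
  shows "horizon (gap_instance K) = K * 2 ^ K"
  unfolding horizon_def
proof (rule Max_eqI)
  show "finite (deadline (gap_instance K) ` jobs (gap_instance K))"
    by (simp add: gap_instance_simps)
  show "y \<le> K * 2 ^ K" if "y \<in> deadline (gap_instance K) ` jobs (gap_instance K)" for y
    using that deadline_le by auto
  have "deadline (gap_instance K) (2 ^ 0 + 0) = K * 2 ^ K"
    by (subst gap_instance_simps(4)) auto
  moreover have "2 ^ 0 + 0 \<in> jobs (gap_instance K)"
    unfolding gap_instance_simps by (rule dyadic_mem) (use assms in auto)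
  ultimately show "K * 2 ^ K \<in> deadline (gap_instance K) ` jobs (gap_instance K)"
    by (metis image_eqI)
qed

lemma valid_gap_instance: "valid_instance (gap_instance K)"
  unfolding valid_instance_def
proof (intro conjI ballI)
  fix j assume j: "j \<in> jobs (gap_instance K)"
  then obtain i a where ia: "i < K" "a < 2 ^ i" "j = 2 ^ i + a"
    unfolding gap_instance_simps(1) by (rule job_cases)
  show "0 < psize (gap_instance K) j" using ia by (simp add: gap_instance_simps)
  show "release (gap_instance K) j + psize (gap_instance K) j \<le> deadline (gap_instance K) j"
    using ia by (simp add: gap_instance_simps)
qed (simp add: gap_instance_simps)

section \<open>The lifted solution\<close>

text \<open>Slots are numbered through the whole level rather than within a window, so that each
  level is a regular grid on the time line; \<open>m div K\<close> recovers the window and hence the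
  job.\<close>

definition slot :: "nat \<Rightarrow> nat \<Rightarrow> nat \<Rightarrow> nat \<times> nat \<times> nat" where
  "slot K i m = (2 ^ i + m div K, m * 2 ^ (K - i), 2 ^ (K - i))"

definition slots :: "nat \<Rightarrow> (nat \<times> nat \<times> nat) set" where
  "slots K = (\<lambda>(i, m). slot K i m) ` (SIGMA i:{..<K}. {..<K * 2 ^ i})"

fun slot_conflict :: "nat \<times> nat \<times> nat \<Rightarrow> nat \<times> nat \<times> nat \<Rightarrow> bool" where
  "slot_conflict (j, t, q) (j', t', q') \<longleftrightarrow> j = j' \<or> t < t' + q' \<and> t' < t + q"

lemma slots_cases:
  assumes "v \<in> slots K"
  obtains i m where "i < K" "m < K * 2 ^ i" "m div K < 2 ^ i" "v = slot K i m"
proof -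
  obtain i m where "i < K" "m < K * 2 ^ i" "v = slot K i m"
    using assms by (auto simp: slots_def)
  then show ?thesis using that by (simp add: less_mult_imp_div_less mult.commute)
qed

text \<open>The length determines the level, and then the start determines the position.\<close>

lemma inj_slot: "inj_on (\<lambda>(i, m). slot K i m) (SIGMA i:{..<K}. {..<K * 2 ^ i})"
proof (rule inj_onI, clarsimp)
  fix i m i' m' assume i: "i < K" "i' < K" and eq: "slot K i m = slot K i' m'"
  have "K - i = K - i'" using eq by (simp add: slot_def)
  then have "i = i'" using i by simp
  then show "i = i' \<and> m = m'" using eq by (simp add: slot_def)
qed

lemma finite_slots: "finite (slots K)"
  by (simp add: slots_def)

lemma sum_slots: "(\<Sum>v\<in>slots K. f v) = (\<Sum>i<K. \<Sum>m<K * 2 ^ i. f (slot K i m))"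
  unfolding slots_def by (subst sum.reindex[OF inj_slot]) (simp add: sum.Sigma split_def)

lemma slots_subset: "slots K \<subseteq> lp_vars (gap_instance K)"
proof
  fix v assume "v \<in> slots K"
  then obtain i m where im: "i < K" "m < K * 2 ^ i" "m div K < 2 ^ i" "v = slot K i m"
    by (rule slots_cases)
  have "(m div K) * K \<le> m" by simp
  then have r: "m div K * (K * 2 ^ (K - i)) \<le> m * 2 ^ (K - i)"
    by (metis mult.assoc mult_le_mono1)
  have "Suc m \<le> Suc (m div K) * K"
    using im by (metis Suc_leI dividend_less_div_times add.commute mult_Suc less_imp_le_nat gr0I not_less_zero mult.commute)
  then have "Suc m * 2 ^ (K - i) \<le> Suc (m div K) * K * 2 ^ (K - i)" by (rule mult_le_mono1)
  then have d: "m * 2 ^ (K - i) + 2 ^ (K - i) \<le> Suc (m div K) * (K * 2 ^ (K - i))"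
    by (simp add: algebra_simps)
  show "v \<in> lp_vars (gap_instance K)"
    using im r d dyadic_mem[OF im(1,3)] by (simp add: lp_vars_def slot_def gap_instance_simps)
qed

lemma finite_lp_vars: 
  assumes "finite (jobs I)"
  shows "finite (lp_vars I)"
proof (rule finite_subset)
  show "lp_vars I \<subseteq> (SIGMA j:jobs I. {..deadline I j} \<times> {..psize I j})"
    by (auto simp: lp_vars_def)
qed (use assms in auto)

section \<open>Clique sizes and the volume in conflict with one slot\<close>

lemma card_job_slots: "card {v \<in> slots K. fst v = j} \<le> K"
proof -
  have "{v \<in> slots K. fst v = j}
      \<subseteq> slot K (floor_log j) ` {(j - 2 ^ floor_log j) * K..<(j - 2 ^ floor_log j) * K + K}"
  proof
    fix v assume "v \<in> {v \<in> slots K. fst v = j}"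
    then have v: "v \<in> slots K" "fst v = j" by auto
    then obtain i m where im: "i < K" "m < K * 2 ^ i" "m div K < 2 ^ i" "v = slot K i m"
      by (auto elim: slots_cases)
    have j: "j = 2 ^ i + m div K" using v im by (simp add: slot_def)
    have i: "floor_log j = i" using im j by (simp add: floor_log_add)
    have "m < m div K * K + K" using im(1) by (metis add.commute dividend_less_div_times gr0I not_less_zero)
    then have "m \<in> {m div K * K..<m div K * K + K}" by simp
    then show "v \<in> slot K (floor_log j) ` {(j - 2 ^ floor_log j) * K..<(j - 2 ^ floor_log j) * K + K}"
      unfolding i using im j by simp
  qed
  then have "card {v \<in> slots K. fst v = j}
      \<le> card (slot K (floor_log j) ` {(j - 2 ^ floor_log j) * K..<(j - 2 ^ floor_log j) * K + K})"
    by (intro card_mono) auto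
  also have "\<dots> \<le> K" using card_image_le by (metis card_atLeastLessThan diff_add_inverse finite_atLeastLessThan)
  finally show ?thesis .
qed

text \<open>The slots of one level are disjoint, so each of the \<open>K\<close> levels contributes
  at most one.\<close>

lemma card_time_slots: "card {(j, t, q) \<in> slots K. t' \<in> {t<..t + q}} \<le> K"
proof -
  have "{(j, t, q) \<in> slots K. t' \<in> {t<..t + q}} \<subseteq> (\<lambda>i. slot K i ((t' - 1) div 2 ^ (K - i))) ` {..<K}"
  proof clarify
    fix j t q assume v: "(j, t, q) \<in> slots K" and t': "t' \<in> {t<..t + q}"
    obtain i m where im: "i < K" "(j, t, q) = slot K i m"
      using v by (auto elim: slots_cases)
    \<comment> \<open>The shift by 1 accounts for slots being open on the left and closed on the
      right.\<close>
    have "(t' - 1) div 2 ^ (K - i) = m"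
      using im t' by (intro div_nat_eqI) (auto simp: slot_def mult.commute)
    then show "(j, t, q) \<in> (\<lambda>i. slot K i ((t' - 1) div 2 ^ (K - i))) ` {..<K}" using im by auto
  qed
  then have "card {(j, t, q) \<in> slots K. t' \<in> {t<..t + q}} \<le> card ((\<lambda>i. slot K i ((t' - 1) div 2 ^ (K - i))) ` {..<K})"
    by (intro card_mono) auto
  also have "\<dots> \<le> K" using card_image_le by (metis card_lessThan finite_lessThan)
  finally show ?thesis .
qed

text \<open>Grid blocks of length \<open>s\<close> meeting an interval of length \<open>q\<close>
  are disjoint and reach beyond it by less than \<open>s\<close> on each side, whence the total
  length bound.\<close>

lemma card_overlapping_multiples:
  fixes s t q :: nat
  assumes "s > 0"
  shows "finite {m. m * s < t + q \<and> t < m * s + s}"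
    and "card {m. m * s < t + q \<and> t < m * s + s} * s \<le> q + 2 * s"
proof -
  have sub: "{m. m * s < t + q \<and> t < m * s + s} \<subseteq> {t div s..(t + q) div s}"
  proof clarify
    fix m assume m: "m * s < t + q" "t < m * s + s"
    have "t div s < Suc m" using m assms by (simp add: div_less_iff_less_mult)
    moreover have "m \<le> (t + q) div s" using m assms by (simp add: less_eq_div_iff_mult_less_eq)
    ultimately show "m \<in> {t div s..(t + q) div s}" by simp
  qed
  then show "finite {m. m * s < t + q \<and> t < m * s + s}" by (rule finite_subset) simp
  have "card {m. m * s < t + q \<and> t < m * s + s} \<le> Suc ((t + q) div s) - t div s"
    using card_mono[OF _ sub] by simp
  then have "card {m. m * s < t + q \<and> t < m * s + s} * s \<le> (Suc ((t + q) div s) - t div s) * s"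
    by (rule mult_le_mono1)
  also have "\<dots> = (t + q) div s * s + s - t div s * s"
    by (simp add: diff_mult_distrib)
  also have "\<dots> \<le> q + 2 * s"
  proof -
    have "(t + q) div s * s \<le> t + q" by simp
    moreover have "t < t div s * s + s" using assms by (metis add.commute dividend_less_div_times)
    ultimately show ?thesis by linarith
  qed
  finally show "card {m. m * s < t + q \<and> t < m * s + s} * s \<le> q + 2 * s" .
qed

definition vlen :: "nat \<times> nat \<times> nat \<Rightarrow> real" where
  "vlen v = real (snd (snd v))"

lemma vlen_slots: "v \<in> slots K \<Longrightarrow> vlen v = real (psize (gap_instance K) (fst v))"
  by (erule slots_cases) (simp add: vlen_def slot_def gap_instance_simps)

lemma vlen_le: "v \<in> slots K \<Longrightarrow> vlen v \<le> 2 ^ K"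
  by (erule slots_cases) (simp add: vlen_def slot_def)

lemma sum_vlen: "(\<Sum>v\<in>slots K. vlen v) = real K * (real K * 2 ^ K)"
proof -
  have "(\<Sum>v\<in>slots K. vlen v) = (\<Sum>i<K. \<Sum>m<K * 2 ^ i. 2 ^ (K - i))"
    by (simp add: sum_slots vlen_def slot_def)
  also have "\<dots> = (\<Sum>i<K. real K * 2 ^ K)"
  proof (rule sum.cong[OF refl])
    fix i assume "i \<in> {..<K}"
    then have "(2::real) ^ i * 2 ^ (K - i) = 2 ^ K" by (simp flip: power_add)
    then show "(\<Sum>m<K * 2 ^ i. 2 ^ (K - i)) = real K * 2 ^ K" by simp
  qed
  finally show ?thesis by simp
qed

text \<open>With \<open>T = K * 2 ^ K\<close>, the at most \<open>K\<close> slots of the same job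
  have total length at most \<open>T\<close>. On each level the overlapping slots have total length
  at most \<open>q + 2 * 2 ^ (K - i)\<close>, which is at most \<open>3 * 2 ^ K\<close>; this gives
  \<open>3 * T\<close> over all levels.\<close>

lemma conflict_loss:
  assumes u: "u \<in> slots K"
  shows "(\<Sum>v\<in>{v \<in> slots K. slot_conflict u v}. vlen v) \<le> 4 * (real K * 2 ^ K)"
proof -
  obtain j t q where jtq: "u = (j, t, q)" by (cases u)
  have q: "real q \<le> 2 ^ K" using vlen_le[OF u] by (simp add: jtq vlen_def)
  define X where "X = {v \<in> slots K. fst v = j}"
  define M where "M i = {m. m * 2 ^ (K - i) < t + q \<and> t < m * 2 ^ (K - i) + 2 ^ (K - i)}" for i
  define Y where "Y = (\<lambda>(i, m). slot K i m) ` (SIGMA i:{..<K}. M i)"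
  have finM: "finite (M i)" and cardM: "card (M i) * 2 ^ (K - i) \<le> q + 2 * 2 ^ (K - i)" for i
    unfolding M_def by (rule card_overlapping_multiples; simp)+
  have finY: "finite (SIGMA i:{..<K}. M i)" using finM by auto
  have nn: "0 \<le> vlen v" for v by (simp add: vlen_def)
  have "{v \<in> slots K. slot_conflict u v} \<subseteq> X \<union> Y"
  proof
    fix v assume v: "v \<in> {v \<in> slots K. slot_conflict u v}"
    then obtain i m where im: "i < K" "m < K * 2 ^ i" "m div K < 2 ^ i" "v = slot K i m"
      by (auto elim: slots_cases)
    have "fst v = j \<or> m \<in> M i" using v im by (auto simp: jtq slot_def M_def)
    then show "v \<in> X \<union> Y" using v im by (auto simp: X_def Y_def)
  qed
  then have "(\<Sum>v\<in>{v \<in> slots K. slot_conflict u v}. vlen v) \<le> (\<Sum>v\<in>X \<union> Y. vlen v)"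
    using finY finite_slots nn by (intro sum_mono2) (auto simp: X_def Y_def)
  also have "\<dots> \<le> (\<Sum>v\<in>X. vlen v) + (\<Sum>v\<in>Y. vlen v)"
    using finY finite_slots nn by (subst sum_Un) (auto simp: X_def Y_def intro!: sum_nonneg)
  also have "(\<Sum>v\<in>X. vlen v) \<le> real K * 2 ^ K"
  proof -
    have "(\<Sum>v\<in>X. vlen v) \<le> of_nat (card X) * 2 ^ K"
      using vlen_le by (intro sum_bounded_above) (auto simp: X_def)
    also have "\<dots> \<le> real K * 2 ^ K"
      using card_job_slots[of K j] by (intro mult_right_mono) (auto simp: X_def)
    finally show ?thesis .
  qed
  also have "(\<Sum>v\<in>Y. vlen v) \<le> (\<Sum>w\<in>(SIGMA i:{..<K}. M i). vlen (case w of (i, m) \<Rightarrow> slot K i m))"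
    unfolding Y_def using sum_image_le[OF finY, of vlen "\<lambda>(i, m). slot K i m"] nn by (simp add: o_def)
  also have "\<dots> = (\<Sum>(i, m)\<in>(SIGMA i:{..<K}. M i). 2 ^ (K - i))"
    by (intro sum.cong) (auto simp: vlen_def slot_def)
  also have "\<dots> = (\<Sum>i<K. \<Sum>m\<in>M i. 2 ^ (K - i))"
    using finM by (intro sum.Sigma[symmetric]) auto
  also have "\<dots> \<le> (\<Sum>i<K. 3 * 2 ^ K)"
  proof (rule sum_mono)
    fix i
    have "real (card (M i)) * 2 ^ (K - i) \<le> real q + 2 * 2 ^ (K - i)"
      using of_nat_mono[OF cardM[of i], where 'a = real] by simp
    moreover have "(2::real) ^ (K - i) \<le> 2 ^ K" by simp
    ultimately show "(\<Sum>m\<in>M i. 2 ^ (K - i)) \<le> (3 * 2 ^ K :: real)"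
      using q unfolding sum_constant by linarith
  qed
  finally show ?thesis by simp
qed

lemma one_plus_power_le:
  fixes p x :: real
  assumes "0 \<le> p" "p * real n \<le> x" "x \<le> 1"
  shows "(1 + p) ^ n \<le> 1 + 2 * x"
proof -
  have x0: "0 \<le> x" using assms mult_nonneg_nonneg[of p "real n"] by linarith
  have "(1 + p) ^ n \<le> exp p ^ n" using assms by (intro power_mono) auto
  also have "\<dots> = exp (p * real n)" by (simp flip: exp_of_nat_mult add: mult.commute)
  also have "\<dots> \<le> exp x" using assms by simp
  also have "\<dots> \<le> 1 + x + x\<^sup>2" using x0 assms by (intro exp_bound) auto
  also have "\<dots> \<le> 1 + 2 * x" using x0 assms mult_left_mono[of x 1 x] by (simp add: power2_eq_square)
  finally show ?thesis .
qed

section \<open>Verification of the lifted constraints\<close>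

lemma SA_gap_instance_nonempty:
  fixes \<epsilon> :: real
  assumes K: "K > 0" and \<epsilon>: "0 < \<epsilon>" "\<epsilon> < 1" and r: "real r \<le> \<epsilon> * real K / 16"
  shows "SA (lp_vars (gap_instance K))
           (lp_system (gap_instance K) (\<epsilon> * real (total_size (gap_instance K)))) r \<noteq> {}"
proof -
  define I where "I = gap_instance K"
  define V where "V = lp_vars I"
  define p where "p = (1 - \<epsilon> / 4) / real K"
  define T where "T = real K * 2 ^ K"
  have T0: "T > 0" using K by (simp add: T_def)
  have p0: "0 \<le> p" using \<epsilon> by (simp add: p_def)
  have pK: "p * real K = 1 - \<epsilon> / 4" using K by (simp add: p_def)
  have finV: "finite V" by (simp add: V_def I_def finite_lp_vars gap_instance_simps)
  have AV: "slots K \<subseteq> V" using slots_subset by (simp add: V_def I_def)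
  interpret hard_core V "slots K" slot_conflict p
  proof
    show "slot_conflict v u" if "slot_conflict u v" for u v
      using that by (cases u; cases v) auto
  qed (use finV AV p0 in auto)
  have T: "(\<Sum>j\<in>jobs I. real (psize I j)) = T"
    using total_size_gap_instance[of K] unfolding total_size_def I_def T_def by (simp flip: of_nat_sum)
  have prK: "p * real n \<le> \<epsilon> / 16" if "n \<le> r" for n
  proof -
    have "real n \<le> \<epsilon> * real K / 16" using that r by linarith
    then have "p * real n \<le> p * (\<epsilon> * real K / 16)" using p0 by (rule mult_left_mono)
    also have "\<dots> = (1 - \<epsilon> / 4) * (\<epsilon> / 16)" unfolding pK[symmetric] by simp
    also have "\<dots> \<le> 1 * (\<epsilon> / 16)" using \<epsilon> by (intro mult_right_mono) auto
    finally show ?thesis by simp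
  qed
  have small: "(1 + p) ^ n \<le> 1 + \<epsilon> / 8" if "n \<le> r" for n
    using one_plus_power_le[OF p0 prK[OF that]] \<epsilon> by simp
  have load: "p * real n \<le> 1 - \<epsilon> / 4" if "n \<le> K" for n
    using mult_left_mono[of "real n" "real K" p] that p0 pK by simp
  have job_cf: "slot_conflict u v" if "fst u = fst v" for u v
    using that by (cases u; cases v) auto

  \<comment> \<open>Even after conditioning, the marginals of each job sum to at most 1. This caps
    the slack of the cost constraint at \<open>\<epsilon> * T\<close>.\<close>
  have upper: "(\<Sum>i\<in>slots K. vlen i * marg U i) \<le> T" if U: "indep U" for U
  proof -
    have one: "(\<Sum>i\<in>{v \<in> slots K. fst v = j}. marg U i) \<le> 1" for j
    proof -
      let ?Q = "{v \<in> slots K. fst v = j}"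
      have Q: "?Q \<subseteq> V" using AV by auto
      show ?thesis
      proof (cases "U \<inter> ?Q = {}")
        case True
        have "(\<Sum>i\<in>?Q. marg U i) \<le> p * card (?Q \<inter> slots K)"
          by (rule clique_marg_miss[OF Q True])
        also have "?Q \<inter> slots K = ?Q" by auto
        also have "p * card ?Q \<le> 1 - \<epsilon> / 4" by (rule load[OF card_job_slots])
        finally show ?thesis using \<epsilon> by simp
      next
        case False
        then obtain u where "u \<in> U" "u \<in> ?Q" by auto
        then have "(\<Sum>i\<in>?Q. marg U i) = 1"
          by (intro clique_marg_hit[OF U Q]) (auto intro: job_cf)
        then show ?thesis by simp
      qed
    qed
    have "(\<Sum>i\<in>slots K. vlen i * marg U i)
        = (\<Sum>j\<in>jobs I. \<Sum>i\<in>{v \<in> slots K. fst v = j}. vlen i * marg U i)"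
      using slots_subset[of K]
      by (intro sum.group[symmetric]) (auto simp: finite_slots I_def gap_instance_simps(1) lp_vars_def)
    also have "\<dots> = (\<Sum>j\<in>jobs I. real (psize I j) * (\<Sum>i\<in>{v \<in> slots K. fst v = j}. marg U i))"
      by (auto simp: sum_distrib_left vlen_slots I_def intro!: sum.cong)
    also have "\<dots> \<le> (\<Sum>j\<in>jobs I. real (psize I j) * 1)"
      using one by (intro sum_mono mult_left_mono) auto
    finally show ?thesis using T by simp
  qed
  \<comment> \<open>One quarter of \<open>\<epsilon> * T\<close> is lost through the factor
    \<open>1 - \<epsilon> / 4\<close> in \<open>p\<close>, another quarter through conditioning,
    since \<open>p * card U \<le> \<epsilon> / 16\<close> and each member of \<open>U\<close> blocks
    volume at most \<open>4 * T\<close>.\<close>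
  have lower: "T - \<epsilon> / 2 * T \<le> (\<Sum>i\<in>slots K. vlen i * marg U i)" if U: "indep U" "card U \<le> r" for U
  proof -
    have "p * (\<Sum>i\<in>slots K. vlen i) - p * card U * (4 * T) \<le> (\<Sum>i\<in>slots K. vlen i * marg U i)"
      using conflict_loss job_cf unfolding T_def
      by (intro marg_sum_lower[OF U(1)]) (auto simp: vlen_def)
    moreover have "p * (\<Sum>i\<in>slots K. vlen i) = (1 - \<epsilon> / 4) * T"
      unfolding sum_vlen pK[symmetric] T_def by simp
    moreover have "p * card U * (4 * T) \<le> \<epsilon> / 16 * (4 * T)"
      using prK[OF U(2)] T0 by (intro mult_right_mono) auto
    ultimately show ?thesis by (simp add: algebra_simps)
  qed

  have "restrict weight {S. S \<subseteq> V \<and> card S \<le> r} \<in> SA V (lp_system I (\<epsilon> * T)) r"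
  proof (rule restrict_weight_in_SA)
    fix a b and S R :: "(nat \<times> nat \<times> nat) set" assume ab: "(a, b) \<in> lp_system I (\<epsilon> * T)" and fin: "finite S" "finite R"
      and SR: "card S + card R + 1 \<le> r"
    have smallR: "(1 + p) ^ card R \<le> 1 + \<epsilon> / 8" using small SR by simp
    consider (cost) "a = (\<lambda>(j, t, q). - real q)" "b = \<epsilon> * T - T"
      | (job) j' where "a = (\<lambda>(j, t, q). if j = j' then 1 else 0)" "b = 1"
      | (time) t' where "a = (\<lambda>(j, t, q). if t' \<in> {t<..t + q} then 1 else 0)" "b = 1"
      | (nonneg) v where "a = (\<lambda>w. if w = v then -1 else 0)" "b = 0" "v \<in> V"
      using ab unfolding lp_system_def T V_def by auto
    then show "(\<Sum>R'\<in>Pow R. (-1) ^ card R' *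
        ((\<Sum>i\<in>V. a i * weight (S \<union> R' \<union> {i})) - b * weight (S \<union> R'))) \<le> 0"
    proof cases
      case cost
      have sl: "slack a b U = \<epsilon> * T - T + (\<Sum>i\<in>slots K. vlen i * marg U i)" if "indep U" for U
      proof -
        have "(\<Sum>i\<in>V. a i * marg U i) = (\<Sum>i\<in>V. - (vlen i * marg U i))"
          by (intro sum.cong) (auto simp: cost vlen_def)
        also have "\<dots> = - (\<Sum>i\<in>V. vlen i * marg U i)" by (rule sum_negf)
        also have "(\<Sum>i\<in>V. vlen i * marg U i) = (\<Sum>i\<in>slots K. vlen i * marg U i)"
          using marg_outside that finV AV by (intro sum.mono_neutral_right) auto
        finally show ?thesis by (simp add: slack_def cost)
      qed
      have lo: "\<epsilon> * T / 2 \<le> slack a b U" if "indep U" "card U \<le> r" for U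
        using lower[OF that] sl[OF that(1)] by (simp add: algebra_simps)
      have hi: "slack a b U \<le> \<epsilon> * T" if "indep U" for U
        using upper[OF that] sl[OF that] by simp
      show ?thesis
      proof (rule lifted_constraint[OF fin, where C = "\<epsilon> * T" and \<eta> = "\<epsilon> * T / 2"])
        show "\<bar>slack a b U\<bar> \<le> \<epsilon> * T" if "indep U" "card U \<le> card S + card R" for U
          using lo[of U] hi[of U] that SR \<epsilon> T0 mult_pos_pos[of \<epsilon> T] by simp
        show "\<epsilon> * T / 2 \<le> slack a b S \<or> (\<forall>U. indep U \<longrightarrow> S \<subseteq> U \<longrightarrow> slack a b U = 0)" if "indep S"
          using lo[OF that] SR by simp
        have "((1 + p) ^ card R - 1) * (\<epsilon> * T) \<le> 1 / 2 * (\<epsilon> * T)"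
          using smallR \<epsilon> T0 by (intro mult_right_mono) auto
        then show "((1 + p) ^ card R - 1) * (\<epsilon> * T) \<le> \<epsilon> * T / 2" by simp
      qed
    next
      case job
      let ?Q = "{v \<in> V. fst v = j'}"
      \<comment> \<open>The constraint ranges over all variables of the job, but only its slots
        count towards the load.\<close>
      have eq: "?Q \<inter> slots K = {v \<in> slots K. fst v = j'}" using AV by auto
      show ?thesis unfolding job(2)
      proof (rule lifted_clique[OF fin, where Q = ?Q and \<eta> = "\<epsilon> / 4"])
        show "p * card (?Q \<inter> slots K) \<le> 1 - \<epsilon> / 4"
          unfolding eq by (rule load[OF card_job_slots])
      qed (use smallR \<epsilon> job job_cf in auto)
    next
      case time
      let ?Q = "{(j, t, q) \<in> V. t' \<in> {t<..t + q}}"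
      have eq: "?Q \<inter> slots K = {(j, t, q) \<in> slots K. t' \<in> {t<..t + q}}" using AV by auto
      show ?thesis unfolding time(2)
      proof (rule lifted_clique[OF fin, where Q = ?Q and \<eta> = "\<epsilon> / 4"])
        show "p * card (?Q \<inter> slots K) \<le> 1 - \<epsilon> / 4"
          unfolding eq by (rule load[OF card_time_slots])
      qed (use smallR \<epsilon> time in \<open>auto split: if_splits\<close>)
    next
      case nonneg
      show ?thesis unfolding nonneg(1,2)
        by (rule lifted_nonneg[OF fin nonneg(3)]) (use smallR \<epsilon> in auto)
    qed
  qed
  moreover have "real (total_size I) = T"
    by (simp add: I_def T_def total_size_gap_instance)
  ultimately show ?thesis unfolding V_def I_def by auto
qed

section \<open>The integrality gap\<close>

text \<open>Rounding both end points inward to the grid loses at most one window at each end; the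
  bound by \<open>N\<close> keeps the windows on the time line.\<close>

lemma card_contained_windows:
  fixes w x l :: real
  assumes w: "0 < w" and x: "0 \<le> x" and N: "x + l \<le> real N * w"
  shows "l / w - 2 \<le> real (card {a. a < N \<and> x \<le> real a * w \<and> real (Suc a) * w \<le> x + l})"
    (is "_ \<le> real (card ?W)")
proof -
  define lo where "lo = nat \<lceil>x / w\<rceil>"
  define hi where "hi = nat \<lfloor>(x + l) / w\<rfloor>"
  have "{lo..<hi} \<subseteq> ?W"
  proof
    fix a assume a: "a \<in> {lo..<hi}"
    have "x / w \<le> real a" using a by (simp add: lo_def)
    then have 1: "x \<le> real a * w" using w by (simp add: field_simps)
    have "int (Suc a) \<le> \<lfloor>(x + l) / w\<rfloor>" using a by (auto simp: hi_def)
    then have "real (Suc a) \<le> (x + l) / w" by (simp add: le_floor_iff)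
    then have 2: "real (Suc a) * w \<le> x + l" using w by (simp add: field_simps)
    then have "real (Suc a) * w \<le> real N * w" using N by linarith
    then have "a < N" using w by simp
    then show "a \<in> ?W" using 1 2 by simp
  qed
  then have "card {lo..<hi} \<le> card ?W" by (intro card_mono) auto
  then have "real hi - real lo \<le> card ?W" by simp
  moreover have "(x + l) / w - 1 \<le> real hi" unfolding hi_def by linarith
  moreover have "real lo \<le> x / w + 1" unfolding lo_def using x w by (simp add: ceiling_correct)
  ultimately show ?thesis by (simp add: add_divide_distrib)
qed

lemma solution_interval:
  assumes sol: "is_solution I q s" and j: "j \<in> jobs I" and q: "0 < q j"
  shows "real (release I j) \<le> s j" "s j + q j \<le> real (deadline I j)"
proof -
  let ?R = "real (release I j)"
  have sub: "{real_of_int (s j)<..real_of_int (s j) + q j} \<subseteq> {?R<..real (deadline I j)}"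
    using sol j q by (simp add: is_solution_def)
  show "?R \<le> s j"
  proof (rule ccontr)
    assume "\<not> ?thesis"
    \<comment> \<open>A point of the processing interval that does not exceed the release
      time.\<close>
    then have "min ?R (s j + q j) \<in> {real_of_int (s j)<..real_of_int (s j) + q j}" using q by auto
    then have "min ?R (s j + q j) \<in> {?R<..real (deadline I j)}" using sub by blast
    then show False by simp
  qed
  have "s j + q j \<in> {real_of_int (s j)<..real_of_int (s j) + q j}" using q by simp
  then have "s j + q j \<in> {?R<..real (deadline I j)}" using sub by blast
  then show "s j + q j \<le> real (deadline I j)" by simp
qed

text \<open>The index set consists of the jobs of levels 0 to \<open>m\<close>. A window of level
  \<open>i\<close> inside the processing interval of such a job leaves its own job no room, so that
  job has length 0. Windows found for different lower jobs are distinct, and each lower job accounts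
  for at least \<open>q j / w - 2\<close> of them.\<close>

lemma lost_jobs:
  assumes K: "K > 0" and sol: "is_solution (gap_instance K) q s" and i: "i < K" and m: "m < i"
  shows "(\<Sum>j\<in>{1..<2 ^ Suc m}. q j) / (real K * 2 ^ (K - i)) - 2 * 2 ^ Suc m
           \<le> card {a. a < 2 ^ i \<and> q (2 ^ i + a) = 0}"
proof -
  let ?I = "gap_instance K"
  define w where "w = real K * 2 ^ (K - i)"
  define W where "W j = {a. a < 2 ^ i \<and> s j \<le> real a * w \<and> real (Suc a) * w \<le> s j + q j}" for j
  let ?J = "{1..<(2::nat) ^ Suc m}"
  have w0: "0 < w" using K by (simp add: w_def)
  have finW: "finite (W j)" for j by (simp add: W_def)
  have mi: "(2::nat) ^ Suc m \<le> 2 ^ i" using m by (intro power_increasing) auto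
  have iK: "(2::nat) ^ i \<le> 2 ^ K" using i by (intro power_increasing) auto
  have J: "?J \<subseteq> jobs ?I" "\<And>j. j \<in> ?J \<Longrightarrow> j < 2 ^ i"
    using mi order.trans[OF mi iK] unfolding gap_instance_simps
    by (meson ivl_subset order_refl, meson atLeastLessThan_iff less_le_trans)
  have q0: "0 \<le> q j" if "j \<in> jobs ?I" for j using sol that by (simp add: is_solution_def)
  have disj: "{real_of_int (s j)<..real_of_int (s j) + q j} \<inter> {real_of_int (s k)<..real_of_int (s k) + q k} = {}"
    if "j \<in> jobs ?I" "k \<in> jobs ?I" "j \<noteq> k" for j k
    using sol that unfolding is_solution_def disjoint_family_on_def by blast
  have count: "q j / w - 2 \<le> card (W j)" if j: "j \<in> ?J" for j
  proof (cases "0 < q j")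
    case True
    have jI: "j \<in> jobs ?I" using j J by blast
    have "0 \<le> real_of_int (s j)" using solution_interval(1)[OF sol jI True] by linarith
    moreover have "s j + q j \<le> real (2 ^ i) * w"
    proof -
      have "real (deadline ?I j) \<le> real (K * 2 ^ K)" using deadline_le[OF jI] by (rule of_nat_mono)
      also have "\<dots> = real (2 ^ i) * w"
        unfolding w_def using i by (simp flip: power_add)
      finally show ?thesis using solution_interval(2)[OF sol jI True] by linarith
    qed
    ultimately show ?thesis unfolding W_def by (rule card_contained_windows[OF w0])
  next
    case False
    then have "q j = 0" using q0 j J by fastforce
    then show ?thesis by (simp add: W_def)
  qed
  \<comment> \<open>The right end of a covered window identifies the covering job, since processing
    intervals are disjoint.\<close>
  have contained: "(Suc a) * w \<in> {real_of_int (s j)<..real_of_int (s j) + q j}" if "a \<in> W j" for a j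
    using that w0 by (auto simp: W_def algebra_simps)
  have disjW: "W j \<inter> W k = {}" if "j \<in> ?J" "k \<in> ?J" "j \<noteq> k" for j k
    using contained[of _ j] contained[of _ k] disj[of j k] that J(1) by blast
  have sub: "(\<Union>j\<in>?J. W j) \<subseteq> {a. a < 2 ^ i \<and> q (2 ^ i + a) = 0}"
  proof
    fix a assume "a \<in> (\<Union>j\<in>?J. W j)"
    then obtain j where j: "j \<in> ?J" "a \<in> W j" by blast
    have a: "a < 2 ^ i" using j by (simp add: W_def)
    let ?k = "2 ^ i + a"
    have kI: "?k \<in> jobs ?I" unfolding gap_instance_simps by (rule dyadic_mem[OF i a])
    have "?k \<noteq> j" using J(2)[OF j(1)] by simp
    have "q ?k = 0"
    proof (rule ccontr)
      assume "q ?k \<noteq> 0"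
      then have qk: "0 < q ?k" using q0[OF kI] by simp
      have "real a * w \<le> s ?k" "s ?k + q ?k \<le> real (Suc a) * w"
        using solution_interval[OF sol kI qk] a by (simp_all add: gap_instance_simps w_def distrib_right)
      then have "s ?k + q ?k \<in> {real_of_int (s j)<..real_of_int (s j) + q j}"
        using j(2) qk by (auto simp: W_def)
      moreover have "s ?k + q ?k \<in> {real_of_int (s ?k)<..real_of_int (s ?k) + q ?k}" using qk by simp
      ultimately show False using disj[OF kI, of j] \<open>?k \<noteq> j\<close> j J(1) by blast
    qed
    then show "a \<in> {a. a < 2 ^ i \<and> q (2 ^ i + a) = 0}" using a by simp
  qed
  have "(\<Sum>j\<in>?J. q j) / w - 2 * 2 ^ Suc m \<le> (\<Sum>j\<in>?J. q j / w - 2)"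
    by (simp add: sum_subtractf sum_divide_distrib of_nat_diff)
  also have "\<dots> \<le> (\<Sum>j\<in>?J. real (card (W j)))" using count by (rule sum_mono)
  also have "\<dots> = card (\<Union>j\<in>?J. W j)"
    using finW disjW by (subst card_UN_disjoint) auto
  also have "\<dots> \<le> card {a. a < 2 ^ i \<and> q (2 ^ i + a) = 0}"
    using sub by (intro of_nat_mono card_mono) auto
  finally show ?thesis unfolding w_def .
qed

section \<open>Averaging the loss over the levels\<close>

text \<open>Here \<open>u\<close> is the volume of one level and \<open>A m\<close> the volume
  processed on levels 0 to \<open>m\<close>, which is at least \<open>(m + 1) * u - D\<close>. Level
  \<open>m + 7\<close> loses at least \<open>A m / K - u / 32\<close>. Summing these losses over
  \<open>m\<close> bounds \<open>D\<close> from below in terms of \<open>D\<close> itself.\<close>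

lemma solution_cost_gap_instance:
  assumes K: "K \<ge> 1000" and sol: "is_solution (gap_instance K) q s"
  shows "solution_cost (gap_instance K) q \<ge> 0.2 * real (total_size (gap_instance K))"
proof -
  let ?I = "gap_instance K"
  define u :: real where "u = 2 ^ K"
  define Q where "Q i = (\<Sum>a<2 ^ i. q (2 ^ i + a))" for i
  define D where "D = solution_cost ?I q"
  have u0: "u > 0" by (simp add: u_def)
  have q: "0 \<le> q (2 ^ i + a) \<and> q (2 ^ i + a) \<le> 2 ^ (K - i)" if "i < K" "a < 2 ^ i" for i a
  proof -
    have "2 ^ i + a \<in> jobs ?I" unfolding gap_instance_simps by (rule dyadic_mem[OF that])
    then have "0 \<le> q (2 ^ i + a) \<and> q (2 ^ i + a) \<le> real (psize ?I (2 ^ i + a))"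
      using sol unfolding is_solution_def by blast
    then show ?thesis using that by (simp add: gap_instance_simps)
  qed
  have lev: "(\<Sum>a<(2::nat) ^ i. 2 ^ (K - i)) = u" if "i < K" for i
    using that by (simp add: u_def flip: power_add)
  have Qu: "Q i \<le> u" if "i < K" for i
    unfolding Q_def lev[OF that, symmetric] using q[OF that] by (intro sum_mono) auto
  have D: "D = (\<Sum>i<K. u - Q i)"
  proof -
    have "D = (\<Sum>i<K. \<Sum>a<2 ^ i. real (psize ?I (2 ^ i + a)) - q (2 ^ i + a))"
      by (simp add: D_def solution_cost_def gap_instance_simps(1) sum_dyadic_blocks flip: One_nat_def)
    also have "\<dots> = (\<Sum>i<K. u - Q i)"
    proof (rule sum.cong[OF refl])
      fix i assume "i \<in> {..<K}"
      then have "i < K" by simp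
      have "(\<Sum>a<2 ^ i. real (psize ?I (2 ^ i + a)) - q (2 ^ i + a))
          = (\<Sum>a<(2::nat) ^ i. 2 ^ (K - i) - q (2 ^ i + a))"
        by (intro sum.cong) (auto simp: gap_instance_simps)
      also have "\<dots> = u - Q i" using lev[OF \<open>i < K\<close>] by (simp only: sum_subtractf Q_def)
      finally show "(\<Sum>a<2 ^ i. real (psize ?I (2 ^ i + a)) - q (2 ^ i + a)) = u - Q i" .
    qed
    finally show ?thesis .
  qed
  define A where "A m = (\<Sum>j\<in>{1..<2 ^ Suc m}. q j)" for m
  have A: "real (Suc m) * u - D \<le> A m" if "m < K" for m
  proof -
    have "(\<Sum>i<Suc m. u - Q i) \<le> D"
      unfolding D using that Qu by (intro sum_mono2) auto
    moreover have "A m = (\<Sum>i<Suc m. Q i)"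
      unfolding A_def Q_def by (rule sum_dyadic_blocks)
    ultimately show ?thesis by (simp add: sum_subtractf algebra_simps)
  qed
  \<comment> \<open>The rounding error of \<open>2 * 2 ^ Suc m\<close> windows, times the job size
    \<open>2 ^ (K - m - 7)\<close>, is \<open>2 ^ (K - 5) = u / 32\<close>; the distance of 7 levels
    makes it this small.\<close>
  have loss: "A m / K - u / 32 \<le> u - Q (m + 7)" if "m < K - 7" for m
  proof -
    define i where "i = m + 7"
    have i: "i < K" "m < i" using that by (auto simp: i_def)
    let ?Z = "{a. a < (2::nat) ^ i \<and> q (2 ^ i + a) = 0}"
    have "A m / (real K * 2 ^ (K - i)) - 2 * 2 ^ Suc m \<le> card ?Z"
      unfolding A_def using K by (intro lost_jobs[OF _ sol i]) auto
    then have le: "(A m / (real K * 2 ^ (K - i)) - 2 * 2 ^ Suc m) * 2 ^ (K - i) \<le> real (card ?Z) * 2 ^ (K - i)"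
      by (rule mult_right_mono) simp
    have eq: "(A m / (real K * 2 ^ (K - i)) - 2 * 2 ^ Suc m) * 2 ^ (K - i) = A m / K - u / 32"
    proof -
      have "u = 2 ^ i * 2 ^ (K - i)" using i by (simp add: u_def flip: power_add)
      also have "(2::real) ^ i = 128 * 2 ^ m" by (simp add: i_def power_add)
      finally have "u / 32 = 2 * 2 ^ Suc m * 2 ^ (K - i)" by simp
      then show ?thesis by (simp add: left_diff_distrib)
    qed
    have ge: "real (card ?Z) * 2 ^ (K - i) \<le> u - Q i"
    proof -
      have "real (card ?Z) * 2 ^ (K - i) = (\<Sum>a\<in>?Z. 2 ^ (K - i) - q (2 ^ i + a))" by simp
      also have "\<dots> \<le> (\<Sum>a<(2::nat) ^ i. 2 ^ (K - i) - q (2 ^ i + a))"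
        using q[OF i(1)] by (intro sum_mono2) auto
      also have "\<dots> = u - Q i" using lev[OF i(1)] by (simp only: sum_subtractf Q_def)
      finally show ?thesis .
    qed
    show ?thesis using order.trans[OF le ge] unfolding eq by (simp add: i_def)
  qed
  define n where "n = K - 7"
  have gauss: "(\<Sum>m<k. real (Suc m)) = real k * (real k + 1) / 2" for k
    by (induction k) (simp_all add: field_simps)
  have D0: "0 \<le> D" unfolding D using Qu by (intro sum_nonneg) auto
  have "(\<Sum>m<n. (real (Suc m) * u - D) / K - u / 32) \<le> (\<Sum>m<n. u - Q (m + 7))"
  proof (rule sum_mono)
    fix m assume "m \<in> {..<n}"
    then have m: "m < K - 7" by (simp add: n_def)
    have "(real (Suc m) * u - D) / K \<le> A m / K" using A[of m] m by (intro divide_right_mono) auto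
    then show "(real (Suc m) * u - D) / K - u / 32 \<le> u - Q (m + 7)" using loss[OF m] by linarith
  qed
  also have "\<dots> = (\<Sum>i\<in>{7..<K}. u - Q i)"
    unfolding n_def by (rule sum.reindex_bij_witness[of _ "\<lambda>i. i - 7" "\<lambda>m. m + 7"]) auto
  also have "\<dots> \<le> D" unfolding D using Qu by (intro sum_mono2) auto
  also have "(\<Sum>m<n. (real (Suc m) * u - D) / K - u / 32)
      = ((\<Sum>m<n. real (Suc m)) * u - n * D) / K - n * (u / 32)"
    by (simp only: sum_subtractf sum_distrib_right sum_divide_distrib diff_divide_distrib sum_constant card_lessThan) simp
  finally have "(real n * (real n + 1) / 2 * u - n * D) / K - n * (u / 32) \<le> D"
    unfolding gauss .
  then have "real n * (real n + 1) / 2 * u - n * D - n * (u / 32) * K \<le> D * K"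
    using K by (simp add: field_simps)
  moreover have "real n * D \<le> K * D" using D0 by (intro mult_right_mono) (auto simp: n_def)
  moreover have "n * (u / 32) * K \<le> K * (u / 32) * K"
    using u0 by (intro mult_right_mono) (auto simp: n_def)
  moreover have "0.98 * real K * real K * u / 2 \<le> real n * (real n + 1) / 2 * u"
  proof -
    \<comment> \<open>This is where \<open>K \<ge> 1000\<close> enters; the square of 0.99 exceeds
      0.98.\<close>
    have n: "0.99 * real K \<le> real n" using K by (simp add: n_def of_nat_diff)
    have "0.98 * real K * real K \<le> (0.99 * real K) * (0.99 * real K)" by simp
    also have "\<dots> \<le> real n * (real n + 1)" using n by (intro mult_mono) auto
    finally have "0.98 * real K * real K * (u / 2) \<le> real n * (real n + 1) * (u / 2)"
      using u0 by (intro mult_right_mono) auto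
    then show ?thesis by (simp add: algebra_simps)
  qed
  ultimately have "0.98 * real K * real K * u / 2 - K * (u / 32) * K \<le> 2 * real K * D"
    using mult.commute[of D "real K"] by linarith
  moreover define X where "X = real K * real K * u"
  ultimately have "0.98 * X / 2 - X / 32 \<le> 2 * real K * D" by (simp add: algebra_simps)
  moreover have "0 \<le> X" using u0 by (simp add: X_def)
  \<comment> \<open>Indeed \<open>0.98 / 2 - 1 / 32 = 0.45875\<close>.\<close>
  ultimately have "0.4 * X \<le> 2 * real K * D" by (simp add: field_simps)
  then have "K * (0.4 * (K * u)) \<le> K * (2 * D)" by (simp add: X_def mult_ac)
  then have "0.4 * (K * u) \<le> 2 * D" using K by simp
  then show ?thesis unfolding D_def total_size_gap_instance u_def by simp
qed

theorem theorem6: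
  "\<exists>c::real. c > 0 \<and> (\<exists>\<epsilon>\<^sub>0::real. \<epsilon>\<^sub>0 > 0 \<and> (\<forall>\<epsilon>::real. 0 < \<epsilon> \<and> \<epsilon> < \<epsilon>\<^sub>0 \<longrightarrow>
     infinite {n::nat. n > 0 \<and>
       (\<exists>I. valid_instance I \<and> card (jobs I) = n \<and> total_size I = horizon I \<and>
          (\<forall>q s. is_solution I q s \<longrightarrow> solution_cost I q \<ge> 0.2 * real (total_size I)) \<and>
          SA (lp_vars I) (lp_system I (\<epsilon> * real (total_size I)))
             (nat \<lfloor>c * \<epsilon> * ln (real n)\<rfloor>) \<noteq> {})}))"
proof (intro exI conjI allI impI)
  \<comment> \<open>The witnesses are \<open>\<epsilon>\<^sub>0 = 1\<close>, fixed by this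
    assumption, and \<open>c = 1 / 16\<close>, fixed by \<open>?N\<close>. The latter suffices
    because \<open>ln (2 ^ K - 1) \<le> K\<close>.\<close>
  fix \<epsilon> :: real assume \<epsilon>: "0 < \<epsilon> \<and> \<epsilon> < 1"
  let ?N = "{n::nat. n > 0 \<and>
       (\<exists>I. valid_instance I \<and> card (jobs I) = n \<and> total_size I = horizon I \<and>
          (\<forall>q s. is_solution I q s \<longrightarrow> solution_cost I q \<ge> 0.2 * real (total_size I)) \<and>
          SA (lp_vars I) (lp_system I (\<epsilon> * real (total_size I)))
             (nat \<lfloor>1 / 16 * \<epsilon> * ln (real n)\<rfloor>) \<noteq> {})}"
  have mem: "2 ^ K - 1 \<in> ?N" if K: "K \<ge> 1000" for K
  proof -
    have K0: "K > 0" using K by simp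
    have pos: "2 ^ K - 1 > (0::nat)" using one_less_power[of "2::nat" K] K0 by simp
    have "real (2 ^ K - 1) \<le> real (2 ^ K)" by (rule of_nat_mono) simp
    then have "ln (real (2 ^ K - 1)) \<le> ln (2 ^ K)"
      using pos by (subst ln_le_cancel_iff) (simp_all only: of_nat_0_less_iff of_nat_power of_nat_numeral zero_less_power zero_less_numeral)
    also have "\<dots> = K * ln 2" by (simp add: ln_realpow)
    also have "\<dots> \<le> real K * 1" using ln_le_minus_one[of "2::real"] by (intro mult_left_mono) auto
    finally have "1 / 16 * \<epsilon> * ln (real (2 ^ K - 1)) \<le> 1 / 16 * \<epsilon> * K"
      using \<epsilon> by (intro mult_left_mono) auto
    moreover have "0 \<le> 1 / 16 * \<epsilon> * ln (real (2 ^ K - 1))"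
      using \<epsilon> pos by (intro mult_nonneg_nonneg ln_ge_zero) linarith+
    ultimately have "real (nat \<lfloor>1 / 16 * \<epsilon> * ln (real (2 ^ K - 1))\<rfloor>) \<le> \<epsilon> * K / 16" by linarith
    then have "SA (lp_vars (gap_instance K))
        (lp_system (gap_instance K) (\<epsilon> * real (total_size (gap_instance K))))
        (nat \<lfloor>1 / 16 * \<epsilon> * ln (real (2 ^ K - 1))\<rfloor>) \<noteq> {}"
      using \<epsilon> by (intro SA_gap_instance_nonempty[OF K0]) auto
    moreover have "card (jobs (gap_instance K)) = 2 ^ K - 1" by (simp add: gap_instance_simps)
    ultimately show ?thesis
      using pos valid_gap_instance total_size_gap_instance horizon_gap_instance[OF K0]
        solution_cost_gap_instance[OF K] by (intro CollectI conjI exI[of _ "gap_instance K"]) auto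
  qed
  show "infinite ?N"
  proof
    assume "finite ?N"
    then obtain m where m: "\<forall>n\<in>?N. n < m" unfolding finite_nat_set_iff_bounded ..
    \<comment> \<open>Adding 1000 to a strict upper bound \<open>m\<close> of the set gives an
      admissible \<open>K\<close> whose number of jobs exceeds that bound.\<close>
    have "2 ^ (m + 1000) - 1 < m" by (rule bspec[OF m mem]) simp
    then show False using less_exp[of "m + 1000"] by linarith
  qed
qed simp_all

end
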